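(* $\mathrm{HNN}\subseteq\mathrm{THR}\circ\mathrm{MAJ}$. Namely, every function $f:\{0,1\}^n\to\{0,1\}$ with an HNN representation with $m$ anchors is computed by a threshold gate applied to $2nm$ majority gates.
   Context: Let $\Delta(\mathbf{x},\mathbf{y})=\|\mathbf{x}-\mathbf{y}\|_2^2$. An HNN representation of $f$ is a pair of disjoint sets $P,N\subseteq\{0,1\}^n$ (anchors, $m=|P|+|N|$) such that $f(\mathbf{x})=1$ if some $\mathbf{p}\in P$ has $\Delta(\mathbf{x},\mathbf{p})<\Delta(\mathbf{x},\mathbf{q})$ for all $\mathbf{q}\in N$, and $f(\mathbf{x})=0$ if some $\mathbf{q}\in N$ has $\Delta(\mathbf{x},\mathbf{q})<\Delta(\mathbf{x},\mathbf{p})$ for all $\mathbf{p}\in P$. $\mathrm{HNN}$ is the class of (families of) functions with HNN representations with polynomially many anchors. A threshold gate is $\mathbf{1}[\langle\mathbf{w},\mathbf{z}\rangle\ge\theta]$ with arbitrary (integer) weights; a majority gate is a threshold gate with integer weights and threshold polynomially bounded in absolute value. $\mathrm{THR}\circ\mathrm{MAJ}$ is the class of functions computed by a threshold gate whose inputs are outputs of polynomially many majority gates, each taking as inputs variables, negated variables, or constants. *)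

theory Defs
  imports "HOL-Analysis.L2_Norm" "HOL-Computational_Algebra.Polynomial"
    "HOL-Library.FuncSet"
begin

text \<open>Since the dimension varies along a family of functions, a point of the Boolean cube is an
  extensional function on \<open>{..<n}\<close>. A function on the cube is only considered on \<open>cube n\<close>.\<close>

definition cube :: "nat \<Rightarrow> (nat \<Rightarrow> int) set" where
  "cube n = {..<n} \<rightarrow>\<^sub>E {0, 1}"

definition boolean_functions :: "nat \<Rightarrow> ((nat \<Rightarrow> int) \<Rightarrow> int) set" where
  "boolean_functions n = cube n \<rightarrow> {0, 1}"

definition sq_dist :: "nat \<Rightarrow> (nat \<Rightarrow> int) \<Rightarrow> (nat \<Rightarrow> int) \<Rightarrow> real" where
  "sq_dist n x y = (L2_set (\<lambda>i. real_of_int (x i - y i)) {..<n})\<^sup>2"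

definition polynomially_bounded :: "(nat \<Rightarrow> nat) \<Rightarrow> bool" where
  "polynomially_bounded s \<longleftrightarrow> (\<exists>p :: nat poly. \<forall>n. s n \<le> poly p n)"

text \<open>The two clauses are equivalences: at every point of the cube the nearest anchors are all
  positive or all negative. With one-directional clauses the value of \<open>f\<close> at a point equidistant
  from \<open>P\<close> and \<open>N\<close> would be arbitrary, and the anchors would not determine \<open>f\<close>.\<close>

definition hnn_representation ::
    "nat \<Rightarrow> (nat \<Rightarrow> int) set \<Rightarrow> (nat \<Rightarrow> int) set \<Rightarrow> ((nat \<Rightarrow> int) \<Rightarrow> int) \<Rightarrow> bool" where
  "hnn_representation n P N f \<longleftrightarrow>
     P \<subseteq> cube n \<and> N \<subseteq> cube n \<and> P \<inter> N = {} \<and>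
     (\<forall>x\<in>cube n.
        (f x = 1 \<longleftrightarrow> (\<exists>p\<in>P. \<forall>q\<in>N. sq_dist n x p < sq_dist n x q)) \<and>
        (f x = 0 \<longleftrightarrow> (\<exists>q\<in>N. \<forall>p\<in>P. sq_dist n x q < sq_dist n x p)))"

definition HNN :: "(nat \<Rightarrow> (nat \<Rightarrow> int) \<Rightarrow> int) set" where
  "HNN = {f. (\<forall>n. f n \<in> boolean_functions n) \<and>
     (\<exists>M. polynomially_bounded M \<and>
        (\<forall>n. \<exists>P N. hnn_representation n P N (f n) \<and> card P + card N \<le> M n))}"

definition threshold_gate :: "'i set \<Rightarrow> ('i \<Rightarrow> int) \<Rightarrow> int \<Rightarrow> ('i \<Rightarrow> int) \<Rightarrow> int" where
  "threshold_gate I w \<theta> z = of_bool ((\<Sum>i\<in>I. w i * z i) \<ge> \<theta>)"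

datatype gate_input = Var nat | NegVar nat | Const bool

definition gate_inputs :: "nat \<Rightarrow> gate_input set" where
  "gate_inputs n = Var ` {..<n} \<union> NegVar ` {..<n} \<union> range Const"

primrec input_value :: "(nat \<Rightarrow> int) \<Rightarrow> gate_input \<Rightarrow> int" where
  "input_value x (Var i) = x i"
| "input_value x (NegVar i) = 1 - x i"
| "input_value x (Const b) = of_bool b"

text \<open>A bottom gate carries one weight per possible input (zero if the input is not used), so
  repeating an input cannot be used to circumvent the bound \<open>B\<close> on weights and threshold.\<close>

definition majority_weights :: "nat \<Rightarrow> nat \<Rightarrow> (gate_input \<Rightarrow> int) \<Rightarrow> int \<Rightarrow> bool" where
  "majority_weights n B w \<theta> \<longleftrightarrow> (\<forall>l\<in>gate_inputs n. \<bar>w l\<bar> \<le> int B) \<and> \<bar>\<theta>\<bar> \<le> int B"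

text \<open>\<open>f\<close> is computed by a threshold gate applied to \<open>s\<close> gates with weights and threshold bounded
  by \<open>B\<close>; these are majority gates when \<open>B\<close> is polynomially bounded in \<open>n\<close>.\<close>

definition computed_by_thr_maj :: "nat \<Rightarrow> nat \<Rightarrow> nat \<Rightarrow> ((nat \<Rightarrow> int) \<Rightarrow> int) \<Rightarrow> bool" where
  "computed_by_thr_maj n s B f \<longleftrightarrow>
     (\<exists>(v :: nat \<Rightarrow> int) (\<theta> :: int) (w :: nat \<Rightarrow> gate_input \<Rightarrow> int) (t :: nat \<Rightarrow> int).
        (\<forall>j<s. majority_weights n B (w j) (t j)) \<and>
        (\<forall>x\<in>cube n. f x =
           threshold_gate {..<s} v \<theta>
             (\<lambda>j. threshold_gate (gate_inputs n) (w j) (t j) (input_value x))))"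

definition THR_MAJ :: "(nat \<Rightarrow> (nat \<Rightarrow> int) \<Rightarrow> int) set" where
  "THR_MAJ = {f. (\<forall>n. f n \<in> boolean_functions n) \<and>
     (\<exists>S B. polynomially_bounded S \<and> polynomially_bounded B \<and>
        (\<forall>n. \<exists>s\<le>S n. computed_by_thr_maj n s (B n) (f n)))}"

end

theory Submission
  imports Defs
begin

text \<open>Let \<open>d\<close> be the Hamming distance, which is the squared Euclidean distance on the cube, and
  let \<open>K = m + 1\<close>. In the sum of \<open>\<plusminus> K ^ (n - d x a)\<close> over all anchors \<open>a\<close>, with the sign recording
  whether \<open>a\<close> is positive, the nearest anchors dominate all others, so the sign of the sum decides
  \<open>f x\<close>. Each exponential telescopes into a constant plus a linear combination of the \<open>n\<close> tests
  \<open>d x a \<le> k\<close> with \<open>k < n\<close>, and each such test is a majority gate because \<open>d x a\<close> is affine in \<open>x\<close>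
  on the cube. Thus \<open>n * m\<close> gates already suffice.\<close>

section \<open>Hamming distance on the Boolean cube\<close>

lemma finite_cube: "finite (cube n)"
  unfolding cube_def by (intro finite_PiE) auto

lemma cube_values: "x \<in> cube n \<Longrightarrow> i < n \<Longrightarrow> x i = 0 \<or> x i = 1"
  by (auto simp: cube_def PiE_def Pi_def)

definition hamming :: "nat \<Rightarrow> (nat \<Rightarrow> int) \<Rightarrow> (nat \<Rightarrow> int) \<Rightarrow> nat" where
  "hamming n x y = card {i. i < n \<and> x i \<noteq> y i}"

lemma hamming_le: "hamming n x y \<le> n"
proof -
  have "hamming n x y \<le> card {..<n}"
    unfolding hamming_def by (intro card_mono) auto
  then show ?thesis by simp
qed

lemma int_hamming: "int (hamming n x y) = (\<Sum>i<n. of_bool (x i \<noteq> y i))"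
proof -
  have "{i. i < n \<and> x i \<noteq> y i} = {..<n} \<inter> {i. x i \<noteq> y i}" by auto
  then show ?thesis by (simp add: hamming_def sum_of_bool_eq)
qed

text \<open>For coordinates in {0, 1} the squared difference is the indicator of
  disagreement.\<close>

lemma sq_dist_eq_hamming:
  assumes "x \<in> cube n" "y \<in> cube n"
  shows "sq_dist n x y = real (hamming n x y)"
proof -
  have "sq_dist n x y = (\<Sum>i<n. (real_of_int (x i - y i))\<^sup>2)"
    by (simp add: sq_dist_def L2_set_def sum_nonneg)
  also have "\<dots> = (\<Sum>i<n. real_of_int (of_bool (x i \<noteq> y i)))"
  proof (rule sum.cong)
    fix i assume "i \<in> {..<n}"
    then show "(real_of_int (x i - y i))\<^sup>2 = real_of_int (of_bool (x i \<noteq> y i))"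
      using cube_values[OF assms(1), of i] cube_values[OF assms(2), of i] by auto
  qed simp
  also have "\<dots> = real_of_int (int (hamming n x y))"
    by (simp add: int_hamming)
  finally show ?thesis by simp
qed

text \<open>The indicator of \<open>x i \<noteq> a i\<close> is \<open>x i\<close> if
  \<open>a i = 0\<close> and \<open>1 - x i\<close> if \<open>a i = 1\<close>; one affine expression
  covers both cases.\<close>

lemma int_hamming_affine:
  assumes "x \<in> cube n" "a \<in> cube n"
  shows "int (hamming n x a) = (\<Sum>i<n. a i) - (\<Sum>i<n. (2 * a i - 1) * x i)"
proof -
  have "of_bool (x i \<noteq> a i) = a i - (2 * a i - 1) * x i" if "i < n" for i
    using cube_values[OF assms(1) that] cube_values[OF assms(2) that] by auto
  then show ?thesis
    by (simp add: int_hamming flip: sum_subtractf)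
qed

section \<open>Distance tests as majority gates\<close>

text \<open>These are the coefficients of the distance to \<open>a\<close> with the sign reversed,
  so that a small distance gives a large gate sum.\<close>

primrec distance_weight :: "(nat \<Rightarrow> int) \<Rightarrow> gate_input \<Rightarrow> int" where
  "distance_weight a (Var i) = 2 * a i - 1"
| "distance_weight a (NegVar i) = 0"
| "distance_weight a (Const b) = 0"

lemma finite_gate_inputs: "finite (gate_inputs n)"
  by (simp add: gate_inputs_def)

lemma threshold_gate_distance:
  assumes "x \<in> cube n" "a \<in> cube n"
  shows "threshold_gate (gate_inputs n) (distance_weight a) ((\<Sum>i<n. a i) - int k) (input_value x)
    = of_bool (hamming n x a \<le> k)"
proof -
  have "(\<Sum>l\<in>gate_inputs n. distance_weight a l * input_value x l)
      = (\<Sum>l\<in>Var ` {..<n}. distance_weight a l * input_value x l)"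
    by (intro sum.mono_neutral_right finite_gate_inputs) (auto simp: gate_inputs_def)
  also have "\<dots> = (\<Sum>i<n. (2 * a i - 1) * x i)"
    by (subst sum.reindex) (auto simp: inj_on_def)
  finally show ?thesis
    unfolding threshold_gate_def using int_hamming_affine[OF assms] by auto
qed

lemma majority_weights_distance:
  assumes a: "a \<in> cube n" and k: "k < n"
  shows "majority_weights n n (distance_weight a) ((\<Sum>i<n. a i) - int k)"
proof -
  have "(\<Sum>i<n. a i) \<le> (\<Sum>i<n. 1)" "(\<Sum>i<n. a i) \<ge> 0"
    using cube_values[OF a] by (fastforce intro: sum_mono, fastforce intro: sum_nonneg)
  then have "\<bar>(\<Sum>i<n. a i) - int k\<bar> \<le> int n"
    using k by simp
  \<comment> \<open>The weights are 0, 1 or -1, and \<open>k < n\<close> gives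
    \<open>1 \<le> n\<close>.\<close>
  moreover have "\<bar>distance_weight a l\<bar> \<le> int n" if "l \<in> gate_inputs n" for l
    using that k cube_values[OF a] by (fastforce simp: gate_inputs_def)
  ultimately show ?thesis
    by (simp add: majority_weights_def)
qed

text \<open>This allows gates to be indexed by any finite set, such as pairs of an anchor and a
  cutoff, and their number to be below \<open>s\<close>: a bijection renumbers them and dummy gates
  fill the rest.\<close>

lemma computed_by_thr_majI:
  fixes v :: "'i \<Rightarrow> int"
  assumes J: "finite J" "card J \<le> s"
    and w: "\<And>j. j \<in> J \<Longrightarrow> majority_weights n B (w j) (t j)"
    and f: "\<And>x. x \<in> cube n \<Longrightarrow> f x =
      threshold_gate J v \<theta> (\<lambda>j. threshold_gate (gate_inputs n) (w j) (t j) (input_value x))"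
  shows "computed_by_thr_maj n s B f"
proof -
  obtain h where h: "bij_betw h {..<card J} J"
    using J(1) ex_bij_betw_nat_finite by (metis atLeast0LessThan)
  \<comment> \<open>A dummy gate tests \<open>0 \<ge> 0\<close> and so outputs 1; its top weight 0
    is what cancels it.\<close>
  define v' where "v' j = (if j < card J then v (h j) else 0)" for j
  define w' where "w' j = (if j < card J then w (h j) else (\<lambda>_. 0))" for j
  define t' where "t' j = (if j < card J then t (h j) else 0)" for j
  have "majority_weights n B (w' j) (t' j)" if "j < s" for j
    using w bij_betwE[OF h] by (auto simp: w'_def t'_def majority_weights_def)
  moreover have "f x = threshold_gate {..<s} v' \<theta>
      (\<lambda>j. threshold_gate (gate_inputs n) (w' j) (t' j) (input_value x))" if "x \<in> cube n" for x
  proof -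
    let ?g = "\<lambda>j. threshold_gate (gate_inputs n) (w j) (t j) (input_value x)"
    let ?g' = "\<lambda>j. threshold_gate (gate_inputs n) (w' j) (t' j) (input_value x)"
    have "(\<Sum>j<s. v' j * ?g' j) = (\<Sum>j<card J. v' j * ?g' j)"
      using J(2) by (intro sum.mono_neutral_right) (auto simp: v'_def)
    also have "\<dots> = (\<Sum>j<card J. v (h j) * ?g (h j))"
      by (simp add: v'_def w'_def t'_def)
    also have "\<dots> = (\<Sum>j\<in>J. v j * ?g j)"
      by (rule sum.reindex_bij_betw[OF h])
    finally show ?thesis
      unfolding f[OF that] threshold_gate_def[of J] threshold_gate_def[of "{..<s}"] by simp
  qed
  ultimately show ?thesis
    unfolding computed_by_thr_maj_def by blast
qed

section \<open>Powers of a large base\<close>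

text \<open>The tests that succeed are those with \<open>d \<le> k < n\<close>; over this range the
  differences telescope down to \<open>K ^ 0\<close>.\<close>

lemma telescope_power:
  fixes K :: int
  assumes "d \<le> n"
  shows "(\<Sum>k<n. (K ^ (n - k) - K ^ (n - Suc k)) * of_bool (d \<le> k)) = K ^ (n - d) - 1"
proof -
  have "(\<Sum>k<n. (K ^ (n - k) - K ^ (n - Suc k)) * of_bool (d \<le> k))
      = (\<Sum>k\<in>{d..<n}. K ^ (n - k) - K ^ (n - Suc k))"
    by (intro sum.mono_neutral_cong_right) auto
  also have "\<dots> = K ^ (n - d) - K ^ (n - n)"
    \<comment> \<open>The negation turns the increments \<open>f (Suc k) - f k\<close> of the rule
      into the decrements needed here.\<close>
    using sum_Suc_diff'[OF assms, of "\<lambda>k. - (K ^ (n - k))"] by simp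
  finally show ?thesis by simp
qed

text \<open>Each term over \<open>B\<close> is at most a \<open>K\<close>-th part of the term of
  \<open>a\<close>, and \<open>B\<close> has fewer than \<open>K\<close> elements.\<close>

lemma nearest_dominates:
  fixes K :: int and d :: "'a \<Rightarrow> nat"
  assumes A: "finite A" "a \<in> A" and K: "int (card B) < K"
    and near: "\<And>b. b \<in> B \<Longrightarrow> d a < d b" and le: "\<And>b. b \<in> B \<Longrightarrow> d b \<le> n"
  shows "(\<Sum>b\<in>B. K ^ (n - d b)) < (\<Sum>b\<in>A. K ^ (n - d b))"
proof -
  have K0: "K > 0" using K by simp
  have "K * K ^ (n - d b) \<le> K ^ (n - d a)" if "b \<in> B" for b
  proof -
    \<comment> \<open>Since \<open>d b \<le> n\<close>, the subtraction does not truncate and the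
      exponent really drops.\<close>
    have "Suc (n - d b) \<le> n - d a"
      using near[OF that] le[OF that] by simp
    then have "K ^ Suc (n - d b) \<le> K ^ (n - d a)"
      using K0 by (intro power_increasing) auto
    then show ?thesis by simp
  qed
  then have "K * (\<Sum>b\<in>B. K ^ (n - d b)) \<le> int (card B) * K ^ (n - d a)"
    unfolding sum_distrib_left by (intro sum_bounded_above)
  also have "\<dots> < K * K ^ (n - d a)"
    using K K0 by simp
  finally have "(\<Sum>b\<in>B. K ^ (n - d b)) < K ^ (n - d a)"
    using K0 by simp
  also have "\<dots> \<le> (\<Sum>b\<in>A. K ^ (n - d b))"
    using A K0 by (intro member_le_sum) auto
  finally show ?thesis .
qed

section \<open>From anchors to a depth-two circuit\<close>

text \<open>The gate count \<open>s\<close> is left free above \<open>n * (card P + card N)\<close>,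
  so that both a bound on the number of anchors and the factor 2 of the theorem can be
  inserted.\<close>

lemma hnn_computed_by_thr_maj:
  assumes f: "f \<in> boolean_functions n" and hnn: "hnn_representation n P N f"
    and s: "n * (card P + card N) \<le> s"
  shows "computed_by_thr_maj n s n f"
proof -
  have sub: "P \<subseteq> cube n" "N \<subseteq> cube n" and disj: "P \<inter> N = {}"
    using hnn by (auto simp: hnn_representation_def)
  have fin: "finite P" "finite N"
    using sub finite_cube finite_subset by blast+
  \<comment> \<open>\<open>K\<close> exceeds both \<open>card P\<close> and \<open>card N\<close>,
    so domination works in either direction.\<close>
  define K :: int where "K = int (card P + card N) + 1"
  define \<sigma> :: "(nat \<Rightarrow> int) \<Rightarrow> int" where "\<sigma> a = (if a \<in> P then 1 else -1)" for a
  define v where "v = (\<lambda>(a, k). \<sigma> a * (K ^ (n - k) - K ^ (n - Suc k)))"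
  define J where "J = (P \<union> N) \<times> {..<n}"
  define w :: "(nat \<Rightarrow> int) \<times> nat \<Rightarrow> gate_input \<Rightarrow> int" where "w = (\<lambda>(a, k). distance_weight a)"
  define t :: "(nat \<Rightarrow> int) \<times> nat \<Rightarrow> int" where "t = (\<lambda>(a, k). (\<Sum>i<n. a i) - int k)"
  have signed_sum: "(\<Sum>a\<in>P \<union> N. \<sigma> a * g a) = sum g P - sum g N" for g
  proof -
    have "(\<Sum>a\<in>P. \<sigma> a * g a) = sum g P"
      by (intro sum.cong) (auto simp: \<sigma>_def)
    moreover have "(\<Sum>a\<in>N. \<sigma> a * g a) = (\<Sum>a\<in>N. - g a)"
      using disj by (intro sum.cong) (auto simp: \<sigma>_def)
    ultimately show ?thesis
      using fin disj by (simp add: sum.union_disjoint sum_negf)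
  qed
  show ?thesis
  \<comment> \<open>Telescoping loses \<open>\<sigma> a\<close> for each anchor \<open>a\<close>,
    which the threshold compensates; the summand 1 expresses strict positivity of an
    integer.\<close>
  proof (rule computed_by_thr_majI[where J = J and v = v and w = w and t = t
        and \<theta> = "1 - (\<Sum>a\<in>P \<union> N. \<sigma> a)"])
    show "finite J"
      using fin by (simp add: J_def)
    show "card J \<le> s"
      using s fin disj by (simp add: J_def card_cartesian_product card_Un_disjoint mult.commute)
    show "majority_weights n n (w j) (t j)" if "j \<in> J" for j
      using that sub majority_weights_distance by (auto simp: J_def w_def t_def)
  next
    fix x assume x: "x \<in> cube n"
    let ?d = "hamming n x"
    let ?g = "\<lambda>j. threshold_gate (gate_inputs n) (w j) (t j) (input_value x)"
    have "(\<Sum>j\<in>J. v j * ?g j) = (\<Sum>a\<in>P \<union> N. \<Sum>k<n. v (a, k) * ?g (a, k))"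
      unfolding J_def by (simp add: sum.cartesian_product)
    also have "\<dots> = (\<Sum>a\<in>P \<union> N. \<sigma> a * (K ^ (n - ?d a) - 1))"
    proof (rule sum.cong)
      fix a assume "a \<in> P \<union> N"
      then have "a \<in> cube n" using sub by auto
      then have "(\<Sum>k<n. v (a, k) * ?g (a, k))
          = \<sigma> a * (\<Sum>k<n. (K ^ (n - k) - K ^ (n - Suc k)) * of_bool (?d a \<le> k))"
        unfolding sum_distrib_left
        by (simp add: v_def w_def t_def threshold_gate_distance[OF x] mult.assoc)
      then show "(\<Sum>k<n. v (a, k) * ?g (a, k)) = \<sigma> a * (K ^ (n - ?d a) - 1)"
        by (simp only: telescope_power[OF hamming_le])
    qed simp
    also have "\<dots> = (\<Sum>a\<in>P. K ^ (n - ?d a)) - (\<Sum>a\<in>N. K ^ (n - ?d a)) - (\<Sum>a\<in>P \<union> N. \<sigma> a)"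
      by (simp only: right_diff_distrib sum_subtractf signed_sum mult_1_right)
    finally have gate: "threshold_gate J v (1 - (\<Sum>a\<in>P \<union> N. \<sigma> a)) ?g
        = of_bool ((\<Sum>a\<in>N. K ^ (n - ?d a)) < (\<Sum>a\<in>P. K ^ (n - ?d a)))"
      by (simp add: threshold_gate_def[of J] algebra_simps)
    have dist: "sq_dist n x a = real (?d a)" if "a \<in> P \<union> N" for a
      using that sub sq_dist_eq_hamming[OF x] by auto
    have "f x = 0 \<or> f x = 1"
      using f x by (auto simp: boolean_functions_def)
    \<comment> \<open>In each case the representation is read from the value of \<open>f\<close> to
      an anchor strictly nearer than all of opposite sign.\<close>
    then show "f x = threshold_gate J v (1 - (\<Sum>a\<in>P \<union> N. \<sigma> a)) ?g"
    proof
      assume "f x = 1"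
      then obtain p where p: "p \<in> P" "\<And>q. q \<in> N \<Longrightarrow> ?d p < ?d q"
        using hnn x dist unfolding hnn_representation_def by fastforce
      have "(\<Sum>a\<in>N. K ^ (n - ?d a)) < (\<Sum>a\<in>P. K ^ (n - ?d a))"
        by (rule nearest_dominates[where d = ?d, OF fin(1) p(1) _ p(2) hamming_le])
          (simp add: K_def)
      with \<open>f x = 1\<close> gate show ?thesis by simp
    next
      assume "f x = 0"
      then obtain q where q: "q \<in> N" "\<And>p. p \<in> P \<Longrightarrow> ?d q < ?d p"
        using hnn x dist unfolding hnn_representation_def by fastforce
      have "(\<Sum>a\<in>P. K ^ (n - ?d a)) < (\<Sum>a\<in>N. K ^ (n - ?d a))"
        by (rule nearest_dominates[where d = ?d, OF fin(2) q(1) _ q(2) hamming_le])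
          (simp add: K_def)
      with \<open>f x = 0\<close> gate show ?thesis by simp
    qed
  qed
qed

lemma polynomially_bounded_id: "polynomially_bounded (\<lambda>n. n)"
  unfolding polynomially_bounded_def by (intro exI[of _ "[:0, 1:]"]) simp

lemma polynomially_bounded_mult_id:
  assumes "polynomially_bounded M"
  shows "polynomially_bounded (\<lambda>n. n * M n)"
proof -
  obtain p :: "nat poly" where "\<And>n. M n \<le> poly p n"
    using assms by (auto simp: polynomially_bounded_def)
  then have "n * M n \<le> poly ([:0, 1:] * p) n" for n by simp
  then show ?thesis
    unfolding polynomially_bounded_def by blast
qed

theorem theorem15:
  "HNN \<subseteq> THR_MAJ \<and>
   (\<exists>B. polynomially_bounded B \<and>
      (\<forall>n m f P N. f \<in> boolean_functions n \<longrightarrow> hnn_representation n P N f \<longrightarrow>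
         card P + card N = m \<longrightarrow> computed_by_thr_maj n (2 * n * m) (B n) f))"
proof
  show "HNN \<subseteq> THR_MAJ"
  proof
    fix f assume "f \<in> HNN"
    then obtain M where f: "\<And>n. f n \<in> boolean_functions n" and M: "polynomially_bounded M"
      and rep: "\<And>n. \<exists>P N. hnn_representation n P N (f n) \<and> card P + card N \<le> M n"
      unfolding HNN_def by blast
    have "computed_by_thr_maj n (n * M n) n (f n)" for n
      using rep[of n] hnn_computed_by_thr_maj[OF f] by (meson mult_le_mono2)
    then show "f \<in> THR_MAJ"
      unfolding THR_MAJ_def
      using f polynomially_bounded_mult_id[OF M] polynomially_bounded_id by blast
  qed
  \<comment> \<open>The bound \<open>B\<close> is the identity: it depends on \<open>n\<close>
    alone, not on the anchors.\<close>
  have "computed_by_thr_maj n (2 * n * m) n f"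
    if "f \<in> boolean_functions n" "hnn_representation n P N f" "card P + card N = m" for n m f P N
    using that by (intro hnn_computed_by_thr_maj) auto
  then show "\<exists>B. polynomially_bounded B \<and>
      (\<forall>n m f P N. f \<in> boolean_functions n \<longrightarrow> hnn_representation n P N f \<longrightarrow>
         card P + card N = m \<longrightarrow> computed_by_thr_maj n (2 * n * m) (B n) f)"
    using polynomially_bounded_id by blast
qed

end
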